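(* Let $(X,\tau)$ be a topological space and let $\mathcal{I}$ be an admissible ideal on $\mathbb{N}$. Then every $\mathcal{I}$-open subset of $X$ is an $\mathcal{I}^{*}$-open subset of $X$.
   Context: An ideal on $\mathbb{N}$ is a family $\mathcal{I}\subseteq P(\mathbb{N})$ such that $A\cup B\in\mathcal{I}$ for all $A,B\in\mathcal{I}$, and $B\in\mathcal{I}$ whenever $A\in\mathcal{I}$ and $B\subseteq A$. It is nontrivial if $\mathcal{I}\neq\emptyset$ and $\mathbb{N}\notin\mathcal{I}$, and admissible if $\{n\}\in\mathcal{I}$ for all $n\in\mathbb{N}$. Ideals are assumed nontrivial, and $\mathscr{F}(\mathcal{I})=\{A\subseteq\mathbb{N}:\mathbb{N}\setminus A\in\mathcal{I}\}$ denotes the associated filter. A sequence $(x_n)$ in $X$ is $\mathcal{I}$-convergent to $x\in X$ if $\{n\in\mathbb{N}:x_n\notin U\}\in\mathcal{I}$ for every neighborhood $U$ of $x$. For $A\subseteq X$, the $\mathcal{I}$-closure $\overline{A}^{\mathcal{I}}$ is the set of all $x\in X$ for which some sequence $(x_n)\subset A$ is $\mathcal{I}$-convergent to $x$. A set $F\subseteq X$ is $\mathcal{I}$-closed if $\overline{F}^{\mathcal{I}}=F$; a set is $\mathcal{I}$-open if its complement in $X$ is $\mathcal{I}$-closed. A sequence $(x_n)$ in $X$ is $\mathcal{I}^{*}$-convergent to $x\in X$ if there exists $M=\{m_1<m_2<\cdots<m_k<\cdots\}\in\mathscr{F}(\mathcal{I})$ such that for every neighborhood $U$ of $x$ there exists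 $N\in\mathbb{N}$ with $x_{m_k}\in U$ for all $m_k>N$. For $A\subseteq X$, the $\mathcal{I}^{*}$-closure $\overline{A}^{\mathcal{I}^{*}}$ is the set of all $x\in X$ for which some sequence $(x_n)\subset A$ is $\mathcal{I}^{*}$-convergent to $x$. A set $F\subseteq X$ is $\mathcal{I}^{*}$-closed if $\overline{F}^{\mathcal{I}^{*}}=F$; a set is $\mathcal{I}^{*}$-open if its complement in $X$ is $\mathcal{I}^{*}$-closed. *)

theory Defs
  imports "HOL-Analysis.Abstract_Topology"
begin

(* The index set of sequences is the type nat. *)

definition nat_ideal :: "nat set set \<Rightarrow> bool" where
  "nat_ideal I \<longleftrightarrow>
     (\<forall>A\<in>I. \<forall>B\<in>I. A \<union> B \<in> I) \<and> (\<forall>A\<in>I. \<forall>B. B \<subseteq> A \<longrightarrow> B \<in> I)"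

definition nontrivial_ideal :: "nat set set \<Rightarrow> bool" where
  "nontrivial_ideal I \<longleftrightarrow> nat_ideal I \<and> I \<noteq> {} \<and> UNIV \<notin> I"

definition admissible_ideal :: "nat set set \<Rightarrow> bool" where
  "admissible_ideal I \<longleftrightarrow> nontrivial_ideal I \<and> (\<forall>n. {n} \<in> I)"

definition ideal_filter :: "nat set set \<Rightarrow> nat set set" where
  "ideal_filter I = {A. UNIV - A \<in> I}"

(* Neighbourhoods need not be open. *)
definition nbhd :: "'a topology \<Rightarrow> 'a \<Rightarrow> 'a set \<Rightarrow> bool" where
  "nbhd X x U \<longleftrightarrow> U \<subseteq> topspace X \<and> (\<exists>V. openin X V \<and> x \<in> V \<and> V \<subseteq> U)"

definition I_convergent ::
  "nat set set \<Rightarrow> 'a topology \<Rightarrow> (nat \<Rightarrow> 'a) \<Rightarrow> 'a \<Rightarrow> bool" where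
  "I_convergent I X s x \<longleftrightarrow>
     range s \<subseteq> topspace X \<and> x \<in> topspace X \<and>
     (\<forall>U. nbhd X x U \<longrightarrow> {n. s n \<notin> U} \<in> I)"

definition I_closure :: "nat set set \<Rightarrow> 'a topology \<Rightarrow> 'a set \<Rightarrow> 'a set" where
  "I_closure I X A = {x \<in> topspace X. \<exists>s. range s \<subseteq> A \<and> I_convergent I X s x}"

definition I_closed :: "nat set set \<Rightarrow> 'a topology \<Rightarrow> 'a set \<Rightarrow> bool" where
  "I_closed I X F \<longleftrightarrow> F \<subseteq> topspace X \<and> I_closure I X F = F"

definition I_open :: "nat set set \<Rightarrow> 'a topology \<Rightarrow> 'a set \<Rightarrow> bool" where
  "I_open I X U \<longleftrightarrow> U \<subseteq> topspace X \<and> I_closed I X (topspace X - U)"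

(* The strictly increasing map m enumerates the (infinite) set M = range m. *)
definition Istar_convergent ::
  "nat set set \<Rightarrow> 'a topology \<Rightarrow> (nat \<Rightarrow> 'a) \<Rightarrow> 'a \<Rightarrow> bool" where
  "Istar_convergent I X s x \<longleftrightarrow>
     range s \<subseteq> topspace X \<and> x \<in> topspace X \<and>
     (\<exists>m :: nat \<Rightarrow> nat. strict_mono m \<and> range m \<in> ideal_filter I \<and>
        (\<forall>U. nbhd X x U \<longrightarrow> (\<exists>N. \<forall>k. m k > N \<longrightarrow> s (m k) \<in> U)))"

definition Istar_closure :: "nat set set \<Rightarrow> 'a topology \<Rightarrow> 'a set \<Rightarrow> 'a set" where
  "Istar_closure I X A = {x \<in> topspace X. \<exists>s. range s \<subseteq> A \<and> Istar_convergent I X s x}"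

definition Istar_closed :: "nat set set \<Rightarrow> 'a topology \<Rightarrow> 'a set \<Rightarrow> bool" where
  "Istar_closed I X F \<longleftrightarrow> F \<subseteq> topspace X \<and> Istar_closure I X F = F"

definition Istar_open :: "nat set set \<Rightarrow> 'a topology \<Rightarrow> 'a set \<Rightarrow> bool" where
  "Istar_open I X U \<longleftrightarrow> U \<subseteq> topspace X \<and> Istar_closed I X (topspace X - U)"

end

theory Submission
  imports Defs
begin

text \<open>I*-convergence is stronger than I-convergence: if \<open>s\<close> tends to
  \<open>x\<close> along a set M of the filter, then the indices at which \<open>s\<close> leaves a
  neighbourhood of \<open>x\<close> lie in the complement of M or in a finite initial segment. Both
  belong to an admissible ideal (\<open>Istar_convergent_imp_I_convergent\<close>). Hence the
  I*-closure lies inside the I-closure. For an I-closed F this squeezes the I*-closure between F, by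
  constant sequences (\<open>subset_Istar_closure\<close>), and F itself; complements then give the
  claim about open sets.\<close>

lemma nat_ideal_subset: "nat_ideal I \<Longrightarrow> A \<in> I \<Longrightarrow> B \<subseteq> A \<Longrightarrow> B \<in> I"
  unfolding nat_ideal_def by blast

lemma nat_ideal_Un: "nat_ideal I \<Longrightarrow> A \<in> I \<Longrightarrow> B \<in> I \<Longrightarrow> A \<union> B \<in> I"
  unfolding nat_ideal_def by blast

lemma admissible_ideal_imp_nat_ideal: "admissible_ideal I \<Longrightarrow> nat_ideal I"
  unfolding admissible_ideal_def nontrivial_ideal_def by blast

lemma admissible_ideal_empty: "admissible_ideal I \<Longrightarrow> {} \<in> I"
  using nat_ideal_subset[of I "{0}" "{}"] admissible_ideal_imp_nat_ideal[of I]
  by (simp add: admissible_ideal_def)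

text \<open>Admissibility enters the main estimate in this form: it allows any initial segment of
  indices to be discarded.\<close>

lemma admissible_ideal_finite:
  assumes "admissible_ideal I" "finite A"
  shows "A \<in> I"
  using assms(2)
proof induction
  case empty
  show ?case by (rule admissible_ideal_empty[OF assms(1)])
next
  case (insert n A)
  have "{n} \<in> I" using assms(1) unfolding admissible_ideal_def by blast
  with insert.IH have "{n} \<union> A \<in> I"
    using nat_ideal_Un[OF admissible_ideal_imp_nat_ideal[OF assms(1)]] by blast
  then show ?case by simp
qed

lemma Istar_convergent_imp_I_convergent:
  assumes "admissible_ideal I" "Istar_convergent I X s x"
  shows "I_convergent I X s x"
proof -
  obtain m :: "nat \<Rightarrow> nat" where M: "UNIV - range m \<in> I"
    and conv: "\<And>U. nbhd X x U \<Longrightarrow> \<exists>N. \<forall>k. m k > N \<longrightarrow> s (m k) \<in> U"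
    using assms(2) unfolding Istar_convergent_def ideal_filter_def by auto
  have "{n. s n \<notin> U} \<in> I" if U: "nbhd X x U" for U
  proof -
    obtain N where N: "\<forall>k. m k > N \<longrightarrow> s (m k) \<in> U" using conv[OF U] by blast
    \<comment> \<open>An index outside the right-hand side is some \<open>m k\<close> with
      \<open>m k > N\<close>, so \<open>s\<close> takes a value in \<open>U\<close> there.\<close>
    have "{n. s n \<notin> U} \<subseteq> (UNIV - range m) \<union> {..N}"
      using N by (auto simp: not_less)
    moreover have "(UNIV - range m) \<union> {..N} \<in> I"
      using nat_ideal_Un[OF admissible_ideal_imp_nat_ideal[OF assms(1)] M]
        admissible_ideal_finite[OF assms(1), of "{..N}"] by simp
    ultimately show ?thesis
      using nat_ideal_subset[OF admissible_ideal_imp_nat_ideal[OF assms(1)]] by blast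
  qed
  then show ?thesis
    using assms(2) by (simp add: I_convergent_def Istar_convergent_def)
qed

lemma Istar_closure_subset_I_closure:
  "admissible_ideal I \<Longrightarrow> Istar_closure I X A \<subseteq> I_closure I X A"
  unfolding Istar_closure_def I_closure_def
  by (auto dest: Istar_convergent_imp_I_convergent)

lemma Istar_convergent_const:
  assumes "admissible_ideal I" "x \<in> topspace X"
  shows "Istar_convergent I X (\<lambda>_. x) x"
proof -
  \<comment> \<open>The identity enumerates all of \<open>nat\<close>, whose complement is the empty
    set.\<close>
  have "range (id :: nat \<Rightarrow> nat) \<in> ideal_filter I"
    using admissible_ideal_empty[OF assms(1)] by (simp add: ideal_filter_def)
  moreover have "strict_mono (id :: nat \<Rightarrow> nat)" by (simp add: strict_mono_def)
  moreover have "\<forall>U. nbhd X x U \<longrightarrow> x \<in> U" by (auto simp: nbhd_def)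
  ultimately show ?thesis
    using assms(2) unfolding Istar_convergent_def by (auto intro!: exI[of _ id])
qed

text \<open>Closedness is an equality of sets, so this inclusion is needed too; each point is the
  limit of its own constant sequence.\<close>

lemma subset_Istar_closure:
  assumes "admissible_ideal I" "A \<subseteq> topspace X"
  shows "A \<subseteq> Istar_closure I X A"
proof
  fix x assume "x \<in> A"
  then have "x \<in> topspace X" "range (\<lambda>_::nat. x) \<subseteq> A" using assms(2) by auto
  then show "x \<in> Istar_closure I X A"
    using Istar_convergent_const[OF assms(1)]
    by (auto simp: Istar_closure_def intro!: exI[of _ "\<lambda>_. x"])
qed

text \<open>A smaller closure that still contains F fixes every F that the larger closure
  fixes.\<close>

lemma I_closed_imp_Istar_closed:
  assumes "admissible_ideal I" "I_closed I X F"
  shows "Istar_closed I X F"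
proof -
  have F: "F \<subseteq> topspace X" "I_closure I X F = F"
    using assms(2) unfolding I_closed_def by simp_all
  have "Istar_closure I X F \<subseteq> F"
    using Istar_closure_subset_I_closure[OF assms(1), of X F] F(2) by simp
  with subset_Istar_closure[OF assms(1) F(1)] F(1) show ?thesis
    unfolding Istar_closed_def by simp
qed

theorem theorem5:
  fixes X :: "'a topology" and I :: "nat set set" and U :: "'a set"
  assumes "admissible_ideal I"
    and "I_open I X U"
  shows "Istar_open I X U"
  using assms(2) by (simp add: I_open_def Istar_open_def I_closed_imp_Istar_closed[OF assms(1)])

end
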